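(* Let $Q=(Q_0,Q_1)$ be a connected acyclic quiver, let $\mathbf{a}\in\mathbb{Z}^{Q_1}$ and $\theta=\mathrm{inc}(\mathbf{a})$, and suppose $\theta$ is generic, $(Q,\theta)$ is tight, and $\mathrm{div}(\mathbf{a})$ is an ample divisor on $\mathcal{M}(Q,\theta)$. Then $Z(\chi_{\theta})=Z^{\mathrm{Cox}}(\Sigma_\theta)$.
   Context: Quiver: finite directed multigraph, arrow $a$ has tail $a^-$, head $a^+$. $\mathrm{inc}(f)_i=\sum_{a^+=i}f(a)-\sum_{a^-=i}f(a)$. A weight is $\theta\in\mathbb{R}^{Q_0}$ with coordinate sum $0$. Subquiver $Q'$: same vertices, arrow subset $Q'_1$; $V\subseteq Q_0$ is $Q'$-successor closed if no arrow of $Q'_1$ goes from $V$ to its complement; $Q'$ is $\theta$-stable (resp. semistable) if $\sum_{i\in V}\theta(i)>0$ (resp. $\ge0$) for every nonempty proper $Q'$-successor closed $V$, and $\theta$-unstable if not semistable. $\theta$ is generic if every $\theta$-semistable subquiver is $\theta$-stable; $(Q,\theta)$ is tight if for each $a\in Q_1$ the subquiver with arrows $Q_1\setminus\{a\}$ is $\theta$-stable. The unstable locus is $Z(\chi_\theta)=\{w\in\mathbb{C}^{Q_1}: \text{the subquiver with arrow set }\{a: w_a\neq 0\}\text{ is }\theta\text{-unstable}\}$. The flow polytope $P(Q,\theta)=\{x\in\mathbb{R}^{Q_1}:x\ge0,\mathrm{inc}(x)=\theta\}$ lies in a translate of $\ker(\mathrm{inc})$; $\Sigma_\theta$ is its normal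 fan in $\ker(\mathrm{inc})^*$, and $\mathcal{M}(Q,\theta)$ is the associated projective toric variety. Under tightness, the rays of $\Sigma_\theta$ are exactly the distinct rays $\rho_a=\mathbb{R}_{\ge0}\,\mathrm{ev}_a$, $a\in Q_1$, where $\mathrm{ev}_a(x)=x_a$ (outward facet normals up to sign convention). Taking coordinates $x_a$ on $\mathbb{C}^{Q_1}=\mathbb{C}^{\Sigma_\theta(1)}$, $Z^{\mathrm{Cox}}(\Sigma_\theta)$ is the common zero set of the monomials $\prod_{a:\rho_a\notin\sigma}x_a$ over all maximal cones $\sigma$ of $\Sigma_\theta$. $\mathrm{div}(\mathbf{a})$ is the class of the torus-invariant divisor $\sum_{a}\mathbf{a}_aD_{\rho_a}$; it is ample iff (standard toric criterion) the polytope $\{m\in\ker(\mathrm{inc})\otimes\mathbb{R}: m(b)\ge -\mathbf{a}_b\ \forall b\in Q_1\}$ has normal fan $\Sigma_\theta$ with each of these inequalities defining a distinct facet. *)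

theory Defs
  imports "HOL-Analysis.Analysis" "Graph_Theory.Graph_Theory"
begin

text \<open>
  A quiver is a \<open>fin_digraph\<close>, that is, a finite directed multigraph with loops allowed. The arrow
  type \<open>'e\<close> is finite, but the arrow set \<open>arcs Q\<close> may be any subset of it, so that
  quivers without arrows are covered. The space \<open>k\<^sup>Q\<^sup>1\<close> of functions on the arrows
  is the coordinate subspace of \<open>k ^ 'e\<close> of vectors vanishing off \<open>arcs Q\<close>.
\<close>

definition arrow_space :: "('v, 'e::finite) pre_digraph \<Rightarrow> ('k::zero ^ 'e) set" where
  "arrow_space Q = {x. \<forall>b. b \<notin> arcs Q \<longrightarrow> x $ b = 0}"

definition acyclic_quiver :: "('v, 'e) pre_digraph \<Rightarrow> bool" where
  "acyclic_quiver Q \<longleftrightarrow> \<not> (\<exists>p. pre_digraph.cycle Q p)"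

definition inc :: "('v, 'e::finite) pre_digraph \<Rightarrow> 'k::ab_group_add ^ 'e \<Rightarrow> 'v \<Rightarrow> 'k" where
  "inc Q f i = (\<Sum>b\<in>{b \<in> arcs Q. head Q b = i}. f $ b) - (\<Sum>b\<in>{b \<in> arcs Q. tail Q b = i}. f $ b)"


section \<open>Stability\<close>

definition subquiver :: "('v, 'e) pre_digraph \<Rightarrow> 'e set \<Rightarrow> ('v, 'e) pre_digraph" where
  "subquiver Q S = Q\<lparr>arcs := S\<rparr>"

definition successor_closed :: "('v, 'e) pre_digraph \<Rightarrow> 'v set \<Rightarrow> bool" where
  "successor_closed R V \<longleftrightarrow>
    V \<subseteq> verts R \<and> \<not> (\<exists>b\<in>arcs R. tail R b \<in> V \<and> head R b \<in> verts R - V)"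

definition stable :: "('v, 'e) pre_digraph \<Rightarrow> ('v \<Rightarrow> real) \<Rightarrow> bool" where
  "stable R \<theta> \<longleftrightarrow>
    (\<forall>V. successor_closed R V \<and> V \<noteq> {} \<and> V \<noteq> verts R \<longrightarrow> (\<Sum>i\<in>V. \<theta> i) > 0)"

definition semistable :: "('v, 'e) pre_digraph \<Rightarrow> ('v \<Rightarrow> real) \<Rightarrow> bool" where
  "semistable R \<theta> \<longleftrightarrow>
    (\<forall>V. successor_closed R V \<and> V \<noteq> {} \<and> V \<noteq> verts R \<longrightarrow> (\<Sum>i\<in>V. \<theta> i) \<ge> 0)"

definition unstable :: "('v, 'e) pre_digraph \<Rightarrow> ('v \<Rightarrow> real) \<Rightarrow> bool" where
  "unstable R \<theta> \<longleftrightarrow> \<not> semistable R \<theta>"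

definition generic :: "('v, 'e) pre_digraph \<Rightarrow> ('v \<Rightarrow> real) \<Rightarrow> bool" where
  "generic Q \<theta> \<longleftrightarrow>
    (\<forall>S \<subseteq> arcs Q. semistable (subquiver Q S) \<theta> \<longrightarrow> stable (subquiver Q S) \<theta>)"

definition tight :: "('v, 'e) pre_digraph \<Rightarrow> ('v \<Rightarrow> real) \<Rightarrow> bool" where
  "tight Q \<theta> \<longleftrightarrow> (\<forall>b\<in>arcs Q. stable (subquiver Q (arcs Q - {b})) \<theta>)"

definition unstable_locus :: "('v, 'e::finite) pre_digraph \<Rightarrow> ('v \<Rightarrow> real) \<Rightarrow> (complex ^ 'e) set" where
  "unstable_locus Q \<theta> =
    {w \<in> arrow_space Q. unstable (subquiver Q {b \<in> arcs Q. w $ b \<noteq> 0}) \<theta>}"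


section \<open>The flow polytope and its normal fan\<close>

definition flow_polytope :: "('v, 'e::finite) pre_digraph \<Rightarrow> ('v \<Rightarrow> real) \<Rightarrow> (real ^ 'e) set" where
  "flow_polytope Q \<theta> =
    {x \<in> arrow_space Q. (\<forall>b\<in>arcs Q. x $ b \<ge> 0) \<and> (\<forall>i\<in>verts Q. inc Q x i = \<theta> i)}"

definition ker_inc :: "('v, 'e::finite) pre_digraph \<Rightarrow> (real ^ 'e) set" where
  "ker_inc Q = {x \<in> arrow_space Q. \<forall>i\<in>verts Q. inc Q x i = 0}"

text \<open>
  Linear functionals on a subspace \<open>K\<close> are functions that are \<open>undefined\<close> off \<open>K\<close>, so that
  equality in \<open>dual_space K\<close> is equality of functionals on \<open>K\<close>.
\<close>

definition dual_space :: "'n::real_vector set \<Rightarrow> ('n \<Rightarrow> real) set" where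
  "dual_space K = {u \<in> extensional K.
    (\<forall>x\<in>K. \<forall>y\<in>K. u (x + y) = u x + u y) \<and> (\<forall>c. \<forall>x\<in>K. u (c *\<^sub>R x) = c * u x)}"

text \<open>
  Inner normal cones: \<open>P\<close> is assumed to lie in a translate of \<open>K\<close>, and \<open>normal_cone K P F\<close> consists
  of the functionals in the dual of \<open>K\<close> that are minimised over \<open>P\<close> at all points of \<open>F\<close>. With this
  sign convention the rays of the normal fan are spanned by the evaluations themselves rather
  than by their negatives.
\<close>

definition normal_cone :: "'n::real_vector set \<Rightarrow> 'n set \<Rightarrow> 'n set \<Rightarrow> ('n \<Rightarrow> real) set" where
  "normal_cone K P F = {u \<in> dual_space K. \<forall>x\<in>F. \<forall>y\<in>P. u (y - x) \<ge> 0}"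

definition normal_fan :: "'n::real_vector set \<Rightarrow> 'n set \<Rightarrow> ('n \<Rightarrow> real) set set" where
  "normal_fan K P = {normal_cone K P F | F. F face_of P \<and> F \<noteq> {}}"

definition maximal_cones :: "('n \<Rightarrow> real) set set \<Rightarrow> ('n \<Rightarrow> real) set set" where
  "maximal_cones \<Sigma> = {\<sigma> \<in> \<Sigma>. \<forall>\<tau>\<in>\<Sigma>. \<sigma> \<subseteq> \<tau> \<longrightarrow> \<tau> = \<sigma>}"

definition flow_fan :: "('v, 'e::finite) pre_digraph \<Rightarrow> ('v \<Rightarrow> real) \<Rightarrow> (real ^ 'e \<Rightarrow> real) set set" where
  "flow_fan Q \<theta> = normal_fan (ker_inc Q) (flow_polytope Q \<theta>)"

definition ev :: "('v, 'e::finite) pre_digraph \<Rightarrow> 'e \<Rightarrow> real ^ 'e \<Rightarrow> real" where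
  "ev Q b = (\<lambda>x\<in>ker_inc Q. x $ b)"

definition arrow_ray :: "('v, 'e::finite) pre_digraph \<Rightarrow> 'e \<Rightarrow> (real ^ 'e \<Rightarrow> real) set" where
  "arrow_ray Q b = {(\<lambda>x\<in>ker_inc Q. t * ev Q b x) | t. t \<ge> 0}"


section \<open>The Cox locus and ampleness\<close>

text \<open>
  The coordinates of Cox's construction are indexed by the arrows, through \<open>b \<mapsto> arrow_ray Q b\<close>.
  A ray of a fan is a ray of a cone \<open>\<sigma>\<close> of that fan iff it is contained in \<open>\<sigma>\<close>.
\<close>

definition cox_locus :: "('v, 'e::finite) pre_digraph \<Rightarrow> (real ^ 'e \<Rightarrow> real) set set \<Rightarrow> (complex ^ 'e) set" where
  "cox_locus Q \<Sigma> = {w \<in> arrow_space Q.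
    \<forall>\<sigma>\<in>maximal_cones \<Sigma>. (\<Prod>b\<in>{b \<in> arcs Q. \<not> arrow_ray Q b \<subseteq> \<sigma>}. w $ b) = 0}"

definition divisor_polytope :: "('v, 'e::finite) pre_digraph \<Rightarrow> int ^ 'e \<Rightarrow> (real ^ 'e) set" where
  "divisor_polytope Q a = {m \<in> ker_inc Q. \<forall>b\<in>arcs Q. m $ b \<ge> - real_of_int (a $ b)}"

definition divisor_facet :: "('v, 'e::finite) pre_digraph \<Rightarrow> int ^ 'e \<Rightarrow> 'e \<Rightarrow> (real ^ 'e) set" where
  "divisor_facet Q a b = {m \<in> divisor_polytope Q a. m $ b = - real_of_int (a $ b)}"

text \<open>
  Ampleness of the class \<open>div(a)\<close> of the torus-invariant divisor with coefficient \<open>a $ b\<close> along the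
  prime divisor of \<open>arrow_ray Q b\<close>, on the toric variety of the fan \<open>flow_fan Q \<theta>\<close>, expressed by the
  toric criterion.
\<close>

definition ample_div :: "('v, 'e::finite) pre_digraph \<Rightarrow> ('v \<Rightarrow> real) \<Rightarrow> int ^ 'e \<Rightarrow> bool" where
  "ample_div Q \<theta> a \<longleftrightarrow>
    normal_fan (ker_inc Q) (divisor_polytope Q a) = flow_fan Q \<theta> \<and>
    (\<forall>b\<in>arcs Q. divisor_facet Q a b facet_of divisor_polytope Q a) \<and>
    inj_on (divisor_facet Q a) (arcs Q)"

end

(*
  Both loci are described by supports of points of the flow polytope P. A subquiver S is semistable
  iff P has a point supported on S (a max-flow min-cut argument). By acyclicity, a point of P of
  minimal support is a vertex v, and its normal cone is maximal and contains ev_b whenever v_b = 0.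
  Conversely, tightness provides for every arrow b a point of P whose b-coordinate is 0; so if F is a
  nonempty face of P, ev_b can lie in the normal cone of F only if x_b = 0 for all x in F. Hence w
  avoids the Cox locus iff the support of w contains the support of a point of P.
*)

theory Submission
  imports Defs
begin

section \<open>Linearity of \<open>inc\<close> and its sum over a vertex set\<close>

lemma verts_subquiver [simp]: "verts (subquiver Q S) = verts Q"
  and arcs_subquiver [simp]: "arcs (subquiver Q S) = S"
  and tail_subquiver [simp]: "tail (subquiver Q S) = tail Q"
  and head_subquiver [simp]: "head (subquiver Q S) = head Q"
  by (simp_all add: subquiver_def)

lemma inc_alt:
  "inc Q x i = (\<Sum>b\<in>arcs Q. (if head Q b = i then x $ b else 0) - (if tail Q b = i then x $ b else 0))"
  by (simp add: inc_def sum_subtractf sum.inter_filter)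

lemma inc_zero [simp]: "inc Q 0 i = 0"
  by (simp add: inc_def)

lemma inc_add: "inc Q (x + y) i = inc Q x i + inc Q y i"
  by (simp add: inc_def sum.distrib algebra_simps)

lemma inc_uminus: "inc Q (- x) i = - inc Q x i"
  using inc_add[of Q x "- x" i] by (simp add: eq_neg_iff_add_eq_0 add.commute)

lemma inc_diff: "inc Q (x - y) i = inc Q x i - inc Q y i"
  using inc_add[of Q x "- y" i] by (simp add: inc_uminus)

lemma inc_scaleR: "inc Q (c *\<^sub>R x) i = c * inc Q x i" for x :: "real ^ 'e::finite"
  by (simp add: inc_def sum_distrib_left right_diff_distrib)

lemma inc_axis:
  assumes "b \<in> arcs Q"
  shows "inc Q (axis b c) i = (if i = head Q b then c else 0) - (if i = tail Q b then c else 0)"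
proof -
  have "inc Q (axis b c) i =
    (\<Sum>b'\<in>arcs Q. if b' = b then (if i = head Q b then c else 0) - (if i = tail Q b then c else 0) else 0)"
    unfolding inc_alt by (rule sum.cong) (auto simp: axis_def)
  then show ?thesis using assms by simp
qed

lemma inc_of_int: "inc Q (\<chi> b. real_of_int (x $ b)) i = real_of_int (inc Q x i)"
  by (simp add: inc_def)

text \<open>This is the cut formula: arrows with both ends in \<open>W\<close> cancel, so only those
  crossing the boundary of \<open>W\<close> contribute, positively when entering and negatively when
  leaving.\<close>

lemma sum_inc:
  assumes "finite W"
  shows "(\<Sum>i\<in>W. inc Q x i) =
    (\<Sum>b\<in>arcs Q. (if head Q b \<in> W then x $ b else 0) - (if tail Q b \<in> W then x $ b else 0))"
  unfolding inc_alt
  by (subst sum.swap, rule sum.cong) (use assms in \<open>auto simp: sum_subtractf\<close>)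

lemma arrow_space_add: "x \<in> arrow_space Q \<Longrightarrow> y \<in> arrow_space Q \<Longrightarrow> x + y \<in> arrow_space Q"
  for x y :: "'k::monoid_add ^ 'e::finite"
  by (simp add: arrow_space_def)

lemma arrow_space_diff: "x \<in> arrow_space Q \<Longrightarrow> y \<in> arrow_space Q \<Longrightarrow> x - y \<in> arrow_space Q"
  for x y :: "'k::group_add ^ 'e::finite"
  by (simp add: arrow_space_def)

lemma arrow_space_axis: "b \<in> arcs Q \<Longrightarrow> axis b c \<in> arrow_space Q"
  by (auto simp: arrow_space_def axis_def)


section \<open>Semistability and nonnegative flows\<close>

text \<open>The distance of \<open>y\<close> from the values allowed on \<open>b\<close>: nonnegative on \<open>S\<close>, zero off \<open>S\<close>.\<close>

definition deficit :: "'e set \<Rightarrow> 'e \<Rightarrow> int \<Rightarrow> int" where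
  "deficit S b y = (if b \<in> S then max 0 (- y) else \<bar>y\<bar>)"

text \<open>
  Reachability of \<open>i\<close> from \<open>s\<close> in a residual graph, in which the arcs satisfying \<open>fw\<close> may be traversed
  forwards and those satisfying \<open>bw\<close> backwards: \<open>z\<close> is the flow along a simple path inside \<open>W\<close>.
\<close>

definition path_flow ::
    "('v, 'e::finite) pre_digraph \<Rightarrow> ('e \<Rightarrow> bool) \<Rightarrow> ('e \<Rightarrow> bool) \<Rightarrow> 'v \<Rightarrow> 'v set \<Rightarrow> 'v \<Rightarrow> int ^ 'e \<Rightarrow> bool" where
  "path_flow Q fw bw s W i z \<longleftrightarrow> z \<in> arrow_space Q \<and>
    (\<forall>j. inc Q z j = (if j = i then 1 else 0) - (if j = s then 1 else 0)) \<and>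
    (\<forall>b. z $ b = 0 \<or>
      tail Q b \<in> W \<and> head Q b \<in> W \<and> (z $ b = 1 \<and> fw b \<or> z $ b = - 1 \<and> bw b))"

text \<open>\<open>W\<close> is chosen maximal among the vertex sets all of whose members are
  reached from \<open>s\<close> by a path flow inside the set. A violated closure condition would
  let a path be prolonged by one arc, enlarging \<open>W\<close>.\<close>

lemma residual_reachable_set:
  assumes "fin_digraph Q" "s \<in> verts Q"
  obtains W where "s \<in> W" "W \<subseteq> verts Q" "\<And>i. i \<in> W \<Longrightarrow> \<exists>z. path_flow Q fw bw s W i z"
    "\<And>b. b \<in> arcs Q \<Longrightarrow> fw b \<Longrightarrow> tail Q b \<in> W \<Longrightarrow> head Q b \<in> W"
    "\<And>b. b \<in> arcs Q \<Longrightarrow> bw b \<Longrightarrow> head Q b \<in> W \<Longrightarrow> tail Q b \<in> W"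
proof -
  interpret fin_digraph Q by fact
  define \<W> where "\<W> = {W. s \<in> W \<and> W \<subseteq> verts Q \<and> (\<forall>i\<in>W. \<exists>z. path_flow Q fw bw s W i z)}"
  have "path_flow Q fw bw s {s} s 0"
    by (auto simp: path_flow_def arrow_space_def)
  then have "{s} \<in> \<W>"
    using assms(2) by (auto simp: \<W>_def)
  moreover have "finite \<W>"
    by (rule finite_subset[of _ "Pow (verts Q)"]) (auto simp: \<W>_def)
  ultimately obtain W where W: "W \<in> \<W>" and max: "\<And>W'. W' \<in> \<W> \<Longrightarrow> W \<subseteq> W' \<Longrightarrow> W = W'"
    using finite_has_maximal[of \<W>] by blast
  \<comment> \<open>Forward and backward traversal are treated together: \<open>c\<close> is the
    sign with which \<open>b\<close> is used when going from \<open>i\<close> to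
    \<open>j\<close>.\<close>
  have step: "j \<in> W" if b: "b \<in> arcs Q" and i: "i \<in> W"
    and cases: "i = tail Q b \<and> j = head Q b \<and> fw b \<and> c = 1 \<or> i = head Q b \<and> j = tail Q b \<and> bw b \<and> c = - 1"
    for b i j and c :: int
  proof (rule ccontr)
    assume j: "j \<notin> W"
    obtain z where z: "path_flow Q fw bw s W i z"
      using W i by (auto simp: \<W>_def)
    \<comment> \<open>The flow \<open>z\<close> lives inside \<open>W\<close> and \<open>b\<close>
      has the end \<open>j\<close> outside, so adding \<open>c\<close> on \<open>b\<close> yields
      exactly 1 or -1.\<close>
    have zb: "z $ b = 0"
      using z j cases by (auto simp: path_flow_def)
    have "path_flow Q fw bw s (insert j W) j (z + axis b c)"
      unfolding path_flow_def
    proof (intro conjI allI)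
      show "z + axis b c \<in> arrow_space Q"
        using z b by (simp add: path_flow_def arrow_space_add arrow_space_axis)
      show "inc Q (z + axis b c) k = (if k = j then 1 else 0) - (if k = s then 1 else 0)" for k
        using z b cases by (auto simp: path_flow_def inc_add inc_axis)
      show "(z + axis b c) $ b' = 0 \<or> tail Q b' \<in> insert j W \<and> head Q b' \<in> insert j W \<and>
          ((z + axis b c) $ b' = 1 \<and> fw b' \<or> (z + axis b c) $ b' = - 1 \<and> bw b')" for b'
      proof (cases "b' = b")
        case True
        then show ?thesis using zb cases i by (auto simp: axis_def)
      next
        case False
        then show ?thesis using z by (auto simp: path_flow_def axis_def)
      qed
    qed
    moreover have "path_flow Q fw bw s W k z' \<Longrightarrow> path_flow Q fw bw s (insert j W) k z'" for k z'
      unfolding path_flow_def by blast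
    moreover have "j \<in> verts Q"
      using cases b by auto
    ultimately have "insert j W \<in> \<W>"
      using W unfolding \<W>_def by blast
    then show False using max[of "insert j W"] j by blast
  qed
  show ?thesis
  proof (rule that[of W])
    show "head Q b \<in> W" if "b \<in> arcs Q" "fw b" "tail Q b \<in> W" for b
      using step[of b "tail Q b" "head Q b" 1] that by blast
    show "tail Q b \<in> W" if "b \<in> arcs Q" "bw b" "head Q b \<in> W" for b
      using step[of b "head Q b" "tail Q b" "- 1"] that by blast
  qed (use W in \<open>auto simp: \<W>_def\<close>)
qed

text \<open>
  Push one unit through \<open>b0\<close> against its deficit and back along a residual path that avoids \<open>b0\<close>.
  If there is no such path, the residual reachable set violates semistability.
\<close>

lemma deficit_decrease:
  fixes Q :: "('v, 'e::finite) pre_digraph" and x :: "int ^ 'e"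
  assumes "fin_digraph Q" "S \<subseteq> arcs Q" "x \<in> arrow_space Q"
    and \<theta>: "\<forall>i\<in>verts Q. \<theta> i = real_of_int (inc Q x i)"
    and ss: "semistable (subquiver Q S) \<theta>"
    and b0: "b0 \<in> arcs Q" "deficit S b0 (x $ b0) > 0"
  obtains x' where "x' \<in> arrow_space Q" "\<And>i. inc Q x' i = inc Q x i"
    "(\<Sum>b\<in>arcs Q. deficit S b (x' $ b)) < (\<Sum>b\<in>arcs Q. deficit S b (x $ b))"
proof -
  interpret fin_digraph Q by fact
  \<comment> \<open>These are the unit changes on arrows other than \<open>b0\<close> that do not
    raise the deficit: an increase on \<open>S\<close> or at a negative value, a decrease at a
    positive value.\<close>
  define fw where "fw b \<longleftrightarrow> b \<noteq> b0 \<and> (b \<in> S \<or> x $ b < 0)" for b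
  define bw where "bw b \<longleftrightarrow> b \<noteq> b0 \<and> x $ b > 0" for b
  \<comment> \<open>Changing \<open>x\<close> by \<open>c\<close> on \<open>b0\<close> moves one
    unit from \<open>t\<close> to \<open>s\<close>; a path flow from \<open>s\<close> to
    \<open>t\<close> closes this to a circulation.\<close>
  define s where "s = (if x $ b0 < 0 then head Q b0 else tail Q b0)"
  define t where "t = (if x $ b0 < 0 then tail Q b0 else head Q b0)"
  define c :: int where "c = (if x $ b0 < 0 then 1 else - 1)"
  have bad: "x $ b0 < 0 \<or> b0 \<notin> S \<and> x $ b0 > 0"
    using b0(2) by (auto simp: deficit_def split: if_splits)
  have st: "s \<in> verts Q" "t \<in> verts Q"
    using b0(1) by (auto simp: s_def t_def)
  obtain W where W: "s \<in> W" "W \<subseteq> verts Q"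
    and pf: "\<And>i. i \<in> W \<Longrightarrow> \<exists>z. path_flow Q fw bw s W i z"
    and clf: "\<And>b. b \<in> arcs Q \<Longrightarrow> fw b \<Longrightarrow> tail Q b \<in> W \<Longrightarrow> head Q b \<in> W"
    and clb: "\<And>b. b \<in> arcs Q \<Longrightarrow> bw b \<Longrightarrow> head Q b \<in> W \<Longrightarrow> tail Q b \<in> W"
    using residual_reachable_set[OF assms(1) st(1), of fw bw] by metis
  have "t \<in> W"
  proof (rule ccontr)
    assume t: "t \<notin> W"
    have finW: "finite W"
      using W(2) finite_verts finite_subset by blast
    have "successor_closed (subquiver Q S) W"
      unfolding successor_closed_def
    proof (intro conjI notI)
      assume "\<exists>b\<in>arcs (subquiver Q S). tail (subquiver Q S) b \<in> W \<and>
        head (subquiver Q S) b \<in> verts (subquiver Q S) - W"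
      then obtain b where b: "b \<in> S" "tail Q b \<in> W" "head Q b \<notin> W"
        by auto
      then have "\<not> fw b"
        using clf assms(2) by blast
      then have "b = b0"
        using b(1) by (auto simp: fw_def)
      \<comment> \<open>If \<open>b0\<close> leaves \<open>W\<close>, then \<open>s\<close> is not
        its head, so \<open>x $ b0\<close> is not negative and \<open>bad\<close> puts
        \<open>b0\<close> outside \<open>S\<close>.\<close>
      then show False
        using b bad W(1) by (auto simp: s_def)
    qed (use W in auto)
    moreover have "W \<noteq> {}" "W \<noteq> verts Q"
      using W(1) t st(2) by auto
    ultimately have "(\<Sum>i\<in>W. \<theta> i) \<ge> 0"
      using ss by (auto simp: semistable_def)
    moreover have "(\<Sum>i\<in>W. \<theta> i) = real_of_int (\<Sum>i\<in>W. inc Q x i)"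
      using \<theta> W(2) by (auto intro!: sum.cong)
    ultimately have "(\<Sum>i\<in>W. inc Q x i) \<ge> 0"
      by (metis of_int_0_le_iff)
    \<comment> \<open>By the closure of \<open>W\<close>, every arrow other than \<open>b0\<close>
      has value \<ge> 0 if it leaves \<open>W\<close> and \<le> 0 if it enters. The arrow
      \<open>b0\<close> joins \<open>s\<close> in \<open>W\<close> to \<open>t\<close> outside, and
      its sign makes its contribution strictly negative.\<close>
    moreover have "(\<Sum>i\<in>W. inc Q x i) < 0"
      unfolding sum_inc[OF finW]
    proof -
      have le: "(if head Q b \<in> W then x $ b else 0) - (if tail Q b \<in> W then x $ b else 0) \<le> 0"
        if "b \<in> arcs Q" "b \<noteq> b0" for b
        using clf[OF that(1)] clb[OF that(1)] that(2) by (fastforce simp: fw_def bw_def)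
      have lt: "(if head Q b0 \<in> W then x $ b0 else 0) - (if tail Q b0 \<in> W then x $ b0 else 0) < 0"
        using bad W(1) t by (auto simp: s_def t_def split: if_splits)
      have "(\<Sum>b\<in>arcs Q. (if head Q b \<in> W then x $ b else 0) - (if tail Q b \<in> W then x $ b else 0))
        < (\<Sum>b\<in>arcs Q. 0)"
      proof (rule sum_strict_mono_ex1)
        show "\<exists>b\<in>arcs Q. (if head Q b \<in> W then x $ b else 0) - (if tail Q b \<in> W then x $ b else 0) < 0"
          using lt b0(1) by blast
        show "\<forall>b\<in>arcs Q. (if head Q b \<in> W then x $ b else 0) - (if tail Q b \<in> W then x $ b else 0) \<le> 0"
          using le lt by (metis order.strict_implies_order)
      qed simp
      then show "(\<Sum>b\<in>arcs Q. (if head Q b \<in> W then x $ b else 0) - (if tail Q b \<in> W then x $ b else 0)) < 0"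
        by simp
    qed
    ultimately show False by simp
  qed
  then obtain z where z: "path_flow Q fw bw s W t z"
    using pf by blast
  define x' where "x' = x + z + axis b0 c"
  have x'b: "x' $ b = x $ b + z $ b" if "b \<noteq> b0" for b
    using that by (simp add: x'_def axis_def)
  have zb0: "z $ b0 = 0"
    using z by (auto simp: path_flow_def fw_def bw_def)
  show ?thesis
  proof (rule that[of x'])
    show "x' \<in> arrow_space Q"
      using z assms(3) b0(1) by (simp add: x'_def path_flow_def arrow_space_add arrow_space_axis)
    show "inc Q x' i = inc Q x i" for i
      using z b0(1) by (auto simp: x'_def path_flow_def inc_add inc_axis s_def t_def c_def)
    show "(\<Sum>b\<in>arcs Q. deficit S b (x' $ b)) < (\<Sum>b\<in>arcs Q. deficit S b (x $ b))"
    proof (rule sum_strict_mono_ex1)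
      have lt: "deficit S b0 (x' $ b0) < deficit S b0 (x $ b0)"
        using bad zb0 by (auto simp: x'_def c_def deficit_def axis_def)
      then show "\<exists>b\<in>arcs Q. deficit S b (x' $ b) < deficit S b (x $ b)"
        using b0(1) by blast
      have "deficit S b (x' $ b) \<le> deficit S b (x $ b)" if "b \<noteq> b0" for b
      proof -
        have "z $ b = 0 \<or> z $ b = 1 \<and> fw b \<or> z $ b = - 1 \<and> bw b"
          using z by (auto simp: path_flow_def)
        then show ?thesis
          unfolding x'b[OF that] by (auto simp: fw_def bw_def deficit_def)
      qed
      then show "\<forall>b\<in>arcs Q. deficit S b (x' $ b) \<le> deficit S b (x $ b)"
        using lt by (metis order.strict_implies_order)
    qed simp
  qed
qed

text \<open>The hard half of max-flow min-cut. Starting from the integral vector \<open>a\<close>,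
  the total deficit is a natural number that can be lowered while positive; at zero the vector is
  nonnegative and supported on \<open>S\<close>.\<close>

lemma semistable_imp_flow:
  fixes Q :: "('v, 'e::finite) pre_digraph" and a :: "int ^ 'e"
  assumes "fin_digraph Q" "S \<subseteq> arcs Q" "a \<in> arrow_space Q"
    and "\<forall>i\<in>verts Q. \<theta> i = real_of_int (inc Q a i)"
    and "semistable (subquiver Q S) \<theta>"
  obtains x where "x \<in> flow_polytope Q \<theta>" "\<And>b. b \<notin> S \<Longrightarrow> x $ b = 0"
proof -
  interpret fin_digraph Q by fact
  have nonneg: "deficit S b y \<ge> 0" for b y
    by (simp add: deficit_def)
  have "\<exists>x. x \<in> arrow_space Q \<and> (\<forall>i\<in>verts Q. \<theta> i = real_of_int (inc Q x i)) \<and>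
      (\<forall>b\<in>arcs Q. deficit S b (x $ b) = 0)"
    using assms(3,4)
  proof (induction "nat (\<Sum>b\<in>arcs Q. deficit S b (a $ b))" arbitrary: a rule: less_induct)
    case less
    show ?case
    proof (cases "\<forall>b\<in>arcs Q. deficit S b (a $ b) = 0")
      case True
      then show ?thesis using less.prems by blast
    next
      case False
      then obtain b0 where b0: "b0 \<in> arcs Q" "deficit S b0 (a $ b0) > 0"
        using nonneg by (metis order_le_less)
      obtain x' where x': "x' \<in> arrow_space Q" "\<And>i. inc Q x' i = inc Q a i"
        "(\<Sum>b\<in>arcs Q. deficit S b (x' $ b)) < (\<Sum>b\<in>arcs Q. deficit S b (a $ b))"
        using deficit_decrease[OF assms(1,2) less.prems assms(5) b0] by metis
      moreover have "(\<Sum>b\<in>arcs Q. deficit S b (x' $ b)) \<ge> 0"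
        by (simp add: sum_nonneg nonneg)
      ultimately show ?thesis
        using less.hyps[of x'] less.prems(2) by auto
    qed
  qed
  then obtain x where x: "x \<in> arrow_space Q" "\<forall>i\<in>verts Q. \<theta> i = real_of_int (inc Q x i)"
      "\<forall>b\<in>arcs Q. deficit S b (x $ b) = 0"
    by blast
  show ?thesis
  proof (rule that[of "\<chi> b. real_of_int (x $ b)"])
    have "x $ b \<ge> 0" if "b \<in> arcs Q" for b
      using x(3) that by (fastforce simp: deficit_def split: if_splits)
    then show "(\<chi> b. real_of_int (x $ b)) \<in> flow_polytope Q \<theta>"
      using x by (simp add: flow_polytope_def arrow_space_def inc_of_int)
    show "(\<chi> b. real_of_int (x $ b)) $ b = 0" if "b \<notin> S" for b
      using x(1,3) that by (cases "b \<in> arcs Q") (auto simp: arrow_space_def deficit_def)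
  qed
qed

text \<open>The easy half: no arrow in the support of \<open>x\<close> leaves a successor closed
  set, so all terms of the cut formula are nonnegative.\<close>

lemma flow_imp_semistable:
  assumes "fin_digraph Q" "x \<in> flow_polytope Q \<theta>" "\<And>b. b \<in> arcs Q \<Longrightarrow> x $ b \<noteq> 0 \<Longrightarrow> b \<in> S"
  shows "semistable (subquiver Q S) \<theta>"
  unfolding semistable_def
proof (intro allI impI, elim conjE)
  interpret fin_digraph Q by fact
  fix V assume V: "successor_closed (subquiver Q S) V"
  then have sub: "V \<subseteq> verts Q" and fin: "finite V"
    using finite_subset[OF _ finite_verts] by (auto simp: successor_closed_def)
  have "(if head Q b \<in> V then x $ b else 0) - (if tail Q b \<in> V then x $ b else 0) \<ge> 0"
    if b: "b \<in> arcs Q" for b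
  proof (cases "x $ b = 0")
    case False
    then have "tail Q b \<in> V \<Longrightarrow> head Q b \<in> V"
      using V assms(3)[OF b] b by (auto simp: successor_closed_def)
    then show ?thesis
      using assms(2) b by (auto simp: flow_polytope_def)
  qed simp
  then have "(\<Sum>i\<in>V. inc Q x i) \<ge> 0"
    unfolding sum_inc[OF fin] by (simp add: sum_nonneg)
  also have "(\<Sum>i\<in>V. inc Q x i) = (\<Sum>i\<in>V. \<theta> i)"
    using assms(2) sub by (auto simp: flow_polytope_def intro!: sum.cong)
  finally show "(\<Sum>i\<in>V. \<theta> i) \<ge> 0" .
qed


section \<open>Vertices of the flow polytope and maximal cones\<close>

lemma ker_inc_add: "x \<in> ker_inc Q \<Longrightarrow> y \<in> ker_inc Q \<Longrightarrow> x + y \<in> ker_inc Q"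
  by (simp add: ker_inc_def arrow_space_add inc_add)

lemma ker_inc_scaleR: "x \<in> ker_inc Q \<Longrightarrow> c *\<^sub>R x \<in> ker_inc Q"
  by (simp add: ker_inc_def arrow_space_def inc_scaleR)

lemma flow_polytope_diff:
  "x \<in> flow_polytope Q \<theta> \<Longrightarrow> y \<in> flow_polytope Q \<theta> \<Longrightarrow> x - y \<in> ker_inc Q"
  by (simp add: ker_inc_def flow_polytope_def arrow_space_diff inc_diff)

text \<open>The arrows with positive value form an acyclic graph. If there are any, some head of
  such an arrow has none leaving it, and there \<open>inc\<close> would be positive.\<close>

lemma nonneg_circulation_eq_0:
  assumes "fin_digraph Q" "acyclic_quiver Q"
    and x: "x \<in> ker_inc Q" "\<And>b. b \<in> arcs Q \<Longrightarrow> x $ b \<ge> 0"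
  shows "x = 0"
proof (rule ccontr)
  assume "x \<noteq> 0"
  interpret fin_digraph Q by fact
  define A where "A = {b \<in> arcs Q. x $ b > 0}"
  define R where "R = (\<lambda>b. (tail Q b, head Q b)) ` A"
  have "R\<^sup>+ \<subseteq> (arcs_ends Q)\<^sup>+"
    by (rule trancl_mono_subset) (auto simp: R_def A_def arcs_ends_def arc_to_ends_def)
  moreover have "(u, u) \<notin> (arcs_ends Q)\<^sup>+" for u
  proof
    assume "(u, u) \<in> (arcs_ends Q)\<^sup>+"
    then obtain p where "awalk u p u" "p \<noteq> []"
      unfolding reachable1_awalk by blast
    then show False
      using assms(2) closed_w_imp_cycle by (auto simp: acyclic_quiver_def closed_w_def)
  qed
  ultimately have "acyclic R"
    by (auto simp: acyclic_def)
  moreover have "finite R"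
    by (simp add: R_def A_def)
  ultimately have "wf (R\<inverse>)"
    by (simp add: finite_acyclic_wf_converse)
  moreover obtain b where "x $ b \<noteq> 0"
    using \<open>x \<noteq> 0\<close> by (auto simp: vec_eq_iff)
  then have "b \<in> A"
    using x by (force simp: A_def ker_inc_def arrow_space_def)
  then have "head Q b \<in> head Q ` A"
    by simp
  ultimately obtain i where "i \<in> head Q ` A" and i: "\<And>j. (j, i) \<in> R\<inverse> \<Longrightarrow> j \<notin> head Q ` A"
    by (rule wfE_min) blast
  then obtain c where c: "c \<in> A" "head Q c = i"
    by blast
  have out: "tail Q d \<noteq> i" if "d \<in> A" for d
    using i[of "head Q d"] that by (auto simp: R_def)
  have "inc Q x i > (\<Sum>b\<in>arcs Q. 0)"
    unfolding inc_alt
  proof (rule sum_strict_mono_ex1)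
    show "\<forall>b\<in>arcs Q. 0 \<le> (if head Q b = i then x $ b else 0) - (if tail Q b = i then x $ b else 0)"
      using x(2) out by (force simp: A_def)
    show "\<exists>b\<in>arcs Q. 0 < (if head Q b = i then x $ b else 0) - (if tail Q b = i then x $ b else 0)"
      using c out[OF c(1)] by (auto simp: A_def intro!: bexI[of _ c])
  qed simp
  moreover have "inc Q x i = 0"
    using x(1) c by (auto simp: ker_inc_def A_def)
  ultimately show False
    by simp
qed

text \<open>Walking from \<open>v\<close> along \<open>u - v\<close> keeps the zeros of
  \<open>v\<close>. Acyclicity forces some coordinate to decrease, so the walk can be continued
  until a further coordinate reaches zero.\<close>

lemma flow_reduce_support:
  assumes "fin_digraph Q" "acyclic_quiver Q"
    and u: "u \<in> flow_polytope Q \<theta>" and v: "v \<in> flow_polytope Q \<theta>" and "u \<noteq> v"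
    and supp: "\<And>b. v $ b = 0 \<Longrightarrow> u $ b = 0"
  obtains y where "y \<in> flow_polytope Q \<theta>" "{b. y $ b \<noteq> 0} \<subset> {b. v $ b \<noteq> 0}"
proof -
  define d where "d = u - v"
  have d: "d \<in> ker_inc Q" "d \<noteq> 0"
    using flow_polytope_diff[OF u v] \<open>u \<noteq> v\<close> by (auto simp: d_def)
  define N where "N = {b \<in> arcs Q. d $ b < 0}"
  have N: "finite N" "N \<noteq> {}"
    using nonneg_circulation_eq_0[OF assms(1,2) d(1)] d(2) by (force simp: N_def)+
  \<comment> \<open>The largest step for which \<open>v + t *\<^sub>R d\<close> remains nonnegative;
    a minimiser \<open>c\<close> is a coordinate that becomes zero.\<close>
  define t where "t = Min ((\<lambda>b. v $ b / - d $ b) ` N)"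
  have t_le: "t \<le> v $ b / - d $ b" if "b \<in> N" for b
    using N that by (simp add: t_def)
  have "t \<in> (\<lambda>b. v $ b / - d $ b) ` N"
    unfolding t_def using N by (intro Min_in) auto
  then obtain c where c: "c \<in> N" "t = v $ c / - d $ c"
    by blast
  have vpos: "v $ b \<ge> 0" if "b \<in> arcs Q" for b
    using v that by (simp add: flow_polytope_def)
  have t: "t \<ge> 0"
    using c vpos by (auto simp: N_def divide_nonneg_neg)
  define y where "y = v + t *\<^sub>R d"
  show ?thesis
  proof (rule that[of y])
    have "y $ b \<ge> 0" if "b \<in> arcs Q" for b
    proof (cases "b \<in> N")
      case True
      then show ?thesis
        using t_le[OF True] by (simp add: y_def N_def field_simps)
    next
      case False
      then show ?thesis
        using that vpos[OF that] t by (simp add: y_def N_def)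
    qed
    then show "y \<in> flow_polytope Q \<theta>"
      using v d(1) by (simp add: flow_polytope_def ker_inc_def y_def inc_add inc_scaleR arrow_space_def)
    have "y $ c = 0"
      using c by (simp add: y_def N_def field_simps)
    \<comment> \<open>Here \<open>u $ c\<close> is nonnegative and smaller than
      \<open>v $ c\<close>, so the loss of \<open>c\<close> makes the inclusion of supports
      strict.\<close>
    moreover have "v $ c \<noteq> 0"
      using c(1) u by (force simp: N_def d_def flow_polytope_def)
    moreover have "y $ b = 0" if "v $ b = 0" for b
      using that supp[OF that] by (simp add: y_def d_def)
    ultimately show "{b. y $ b \<noteq> 0} \<subset> {b. v $ b \<noteq> 0}"
      by blast
  qed
qed

section \<open>Evaluations, arrow rays and maximal normal cones\<close>

lemma ev_in_normal_cone_iff: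
  assumes "F \<subseteq> flow_polytope Q \<theta>"
  shows "ev Q b \<in> normal_cone (ker_inc Q) (flow_polytope Q \<theta>) F \<longleftrightarrow>
    (\<forall>x\<in>F. \<forall>y\<in>flow_polytope Q \<theta>. x $ b \<le> y $ b)"
proof -
  have "ev Q b \<in> dual_space (ker_inc Q)"
    by (auto simp: dual_space_def ev_def ker_inc_add ker_inc_scaleR)
  moreover have "ev Q b (y - x) = y $ b - x $ b" if "x \<in> F" "y \<in> flow_polytope Q \<theta>" for x y
    using flow_polytope_diff[of y Q \<theta> x] that assms by (auto simp: ev_def)
  ultimately show ?thesis
    by (auto simp: normal_cone_def)
qed

text \<open>Normal cones are closed under nonnegative scaling, so containing a ray amounts to
  containing its generator.\<close>

lemma arrow_ray_subset_iff:
  assumes "F \<subseteq> flow_polytope Q \<theta>"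
  shows "arrow_ray Q b \<subseteq> normal_cone (ker_inc Q) (flow_polytope Q \<theta>) F \<longleftrightarrow> ev Q b \<in> normal_cone (ker_inc Q) (flow_polytope Q \<theta>) F"
proof
  assume "arrow_ray Q b \<subseteq> normal_cone (ker_inc Q) (flow_polytope Q \<theta>) F"
  moreover have "ev Q b \<in> arrow_ray Q b"
    by (auto simp: arrow_ray_def ev_def intro!: exI[of _ 1])
  ultimately show "ev Q b \<in> normal_cone (ker_inc Q) (flow_polytope Q \<theta>) F"
    by blast
next
  assume ev: "ev Q b \<in> normal_cone (ker_inc Q) (flow_polytope Q \<theta>) F"
  show "arrow_ray Q b \<subseteq> normal_cone (ker_inc Q) (flow_polytope Q \<theta>) F"
  proof
    fix u assume "u \<in> arrow_ray Q b"
    then obtain t where t: "t \<ge> 0" "u = (\<lambda>x\<in>ker_inc Q. t * ev Q b x)"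
      by (auto simp: arrow_ray_def)
    have "u \<in> dual_space (ker_inc Q)"
      using t by (auto simp: dual_space_def ev_def ker_inc_add ker_inc_scaleR algebra_simps)
    moreover have "y - x \<in> ker_inc Q" if "x \<in> F" "y \<in> flow_polytope Q \<theta>" for x y
      using flow_polytope_diff[of y Q \<theta> x] that assms by blast
    ultimately show "u \<in> normal_cone (ker_inc Q) (flow_polytope Q \<theta>) F"
      using ev t by (auto simp: normal_cone_def)
  qed
qed

text \<open>The cone is the normal cone of a point \<open>v\<close> of minimal support inside the
  support of \<open>x\<close>.\<close>

lemma flow_imp_maximal_cone:
  assumes "fin_digraph Q" "acyclic_quiver Q"
    and x: "x \<in> flow_polytope Q \<theta>"
  obtains \<sigma> where "\<sigma> \<in> maximal_cones (flow_fan Q \<theta>)"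
    "\<And>b. b \<in> arcs Q \<Longrightarrow> \<not> arrow_ray Q b \<subseteq> \<sigma> \<Longrightarrow> x $ b \<noteq> 0"
proof -
  let ?P = "flow_polytope Q \<theta>" and ?N = "normal_cone (ker_inc Q) (flow_polytope Q \<theta>)"
  obtain v where v: "v \<in> ?P" "{b. v $ b \<noteq> 0} \<subseteq> {b. x $ b \<noteq> 0}"
    and min: "\<And>y. y \<in> ?P \<Longrightarrow> \<not> {b. y $ b \<noteq> 0} \<subset> {b. v $ b \<noteq> 0}"
  proof -
    have "finite ((\<lambda>y. {b. y $ b \<noteq> 0}) ` ?P)" by simp
    then obtain T where T: "T \<in> (\<lambda>y. {b. y $ b \<noteq> 0}) ` ?P" "T \<subseteq> {b. x $ b \<noteq> 0}"
      "\<forall>T'\<in>(\<lambda>y. {b. y $ b \<noteq> 0}) ` ?P. T' \<subseteq> T \<longrightarrow> T = T'"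
      using finite_has_minimal2[of "(\<lambda>y. {b. y $ b \<noteq> 0}) ` ?P" "{b. x $ b \<noteq> 0}"] x by blast
    then obtain v where "v \<in> ?P" "T = {b. v $ b \<noteq> 0}"
      by blast
    with T show ?thesis
      by (intro that[of v]) blast+
  qed
  \<comment> \<open>A second point vanishing wherever \<open>v\<close> does would permit a reduction
    of the minimal support.\<close>
  have uniq: "u = v" if "u \<in> ?P" "\<And>b. v $ b = 0 \<Longrightarrow> u $ b = 0" for u
    using flow_reduce_support[OF assms(1,2) that(1) v(1)] that(2) min by metis
  have "v extreme_point_of ?P"
    unfolding extreme_point_of_def
  proof (intro conjI ballI notI)
    fix p q assume pq: "p \<in> ?P" "q \<in> ?P" and "v \<in> open_segment p q"
    then obtain r where r: "0 < r" "r < 1" "v = (1 - r) *\<^sub>R p + r *\<^sub>R q" and "p \<noteq> q"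
      by (auto simp: in_segment)
    \<comment> \<open>A convex combination of nonnegative numbers with positive weights is zero only
      if both are, so \<open>uniq\<close> applies to both endpoints.\<close>
    have "p $ b = 0 \<and> q $ b = 0" if "v $ b = 0" for b
    proof -
      have nn: "p $ b \<ge> 0" "q $ b \<ge> 0"
        using pq by (cases "b \<in> arcs Q"; simp add: flow_polytope_def arrow_space_def)+
      have "(1 - r) * p $ b + r * q $ b = 0"
        using that r(3) by simp
      then show ?thesis
        using r(1,2) nn by (simp add: add_nonneg_eq_0_iff)
    qed
    then have "p = v" "q = v"
      using uniq pq by blast+
    with \<open>p \<noteq> q\<close> show False by simp
  qed (fact v(1))
  then have "?N {v} \<in> flow_fan Q \<theta>"
    by (auto simp: flow_fan_def normal_fan_def face_of_singleton intro!: exI[of _ "{v}"])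
  moreover have ev: "ev Q b \<in> ?N {v}" if "v $ b = 0" for b
  proof -
    have "v $ b \<le> y $ b" if "y \<in> ?P" for y
      using that \<open>v $ b = 0\<close> by (cases "b \<in> arcs Q") (auto simp: flow_polytope_def arrow_space_def)
    then show ?thesis
      using ev_in_normal_cone_iff[of "{v}" Q \<theta> b] v(1) by simp
  qed
  \<comment> \<open>If \<tau> is the normal cone of \<open>G\<close>, it contains
    \<open>ev Q b\<close> for every zero \<open>b\<close> of \<open>v\<close>. Comparing points of
    \<open>G\<close> with \<open>v\<close> shows that they vanish there too, so \<open>uniq\<close>
    leaves only \<open>v\<close>.\<close>
  moreover have "\<tau> = ?N {v}" if \<tau>: "\<tau> \<in> flow_fan Q \<theta>" "?N {v} \<subseteq> \<tau>" for \<tau>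
  proof -
    obtain G where G: "\<tau> = ?N G" "G \<subseteq> ?P" "G \<noteq> {}"
      using \<tau>(1) by (auto simp: flow_fan_def normal_fan_def dest: face_of_imp_subset)
    have "u = v" if "u \<in> G" for u
    proof (rule uniq)
      show "u $ b = 0" if "v $ b = 0" for b
      proof -
        have "u $ b \<le> v $ b"
          using ev[OF that] \<tau>(2) G \<open>u \<in> G\<close> v(1) ev_in_normal_cone_iff[of G Q \<theta> b] by blast
        then show ?thesis
          using that G(2) \<open>u \<in> G\<close>
          by (cases "b \<in> arcs Q") (force simp: flow_polytope_def arrow_space_def)+
      qed
    qed (use that G(2) in blast)
    then have "G = {v}"
      using G(3) by blast
    then show ?thesis using G(1) by simp
  qed
  ultimately have "?N {v} \<in> maximal_cones (flow_fan Q \<theta>)"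
    by (auto simp: maximal_cones_def)
  then show ?thesis
  proof (rule that)
    show "x $ b \<noteq> 0" if "\<not> arrow_ray Q b \<subseteq> ?N {v}" for b
      using ev v that arrow_ray_subset_iff[of "{v}" Q \<theta> b] by auto
  qed
qed

section \<open>Equality of the two loci\<close>

theorem theorem3p7:
  fixes Q :: "('v, 'e::finite) pre_digraph"
    and a :: "int ^ 'e"
    and \<theta> :: "'v \<Rightarrow> real"
  assumes "fin_digraph Q"
    and "Digraph_Component.connected Q"
    and "acyclic_quiver Q"
    and "a \<in> arrow_space Q"
    and "\<forall>i\<in>verts Q. \<theta> i = real_of_int (inc Q a i)"
    and "generic Q \<theta>"
    and "tight Q \<theta>"
    and "ample_div Q \<theta> a"
  shows "unstable_locus Q \<theta> = cox_locus Q (flow_fan Q \<theta>)"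
proof -
  let ?P = "flow_polytope Q \<theta>" and ?N = "normal_cone (ker_inc Q) (flow_polytope Q \<theta>)"
  \<comment> \<open>Tightness enters here: deleting \<open>b\<close> leaves a stable, hence
    semistable, subquiver, which carries a flow.\<close>
  have facet: "\<exists>y\<in>?P. y $ b = 0" if "b \<in> arcs Q" for b
  proof -
    have "semistable (subquiver Q (arcs Q - {b})) \<theta>"
      using assms(7) that by (force simp: tight_def stable_def semistable_def)
    then show ?thesis
      using semistable_imp_flow[OF assms(1) _ assms(4,5)] by (metis Diff_iff Diff_subset singletonI)
  qed
  have "semistable (subquiver Q {b \<in> arcs Q. w $ b \<noteq> 0}) \<theta> \<longleftrightarrow> w \<notin> cox_locus Q (flow_fan Q \<theta>)"
    if w: "w \<in> arrow_space Q" for w :: "complex ^ 'e"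
  proof
    assume "semistable (subquiver Q {b \<in> arcs Q. w $ b \<noteq> 0}) \<theta>"
    then obtain x where x: "x \<in> ?P" "\<And>b. b \<notin> {b \<in> arcs Q. w $ b \<noteq> 0} \<Longrightarrow> x $ b = 0"
      by (rule semistable_imp_flow[OF assms(1) Collect_subset assms(4,5)]) blast
    obtain \<sigma> where "\<sigma> \<in> maximal_cones (flow_fan Q \<theta>)"
      "\<And>b. b \<in> arcs Q \<Longrightarrow> \<not> arrow_ray Q b \<subseteq> \<sigma> \<Longrightarrow> x $ b \<noteq> 0"
      using flow_imp_maximal_cone[OF assms(1,3) x(1)] by metis
    \<comment> \<open>The arrows indexing the monomial of \<sigma> lie in the support of
      \<open>x\<close>, hence in that of \<open>w\<close>, so this monomial does not vanish at
      \<open>w\<close>.\<close>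
    with x(2) show "w \<notin> cox_locus Q (flow_fan Q \<theta>)"
      by (auto simp: cox_locus_def)
  next
    assume "w \<notin> cox_locus Q (flow_fan Q \<theta>)"
    then obtain \<sigma> where \<sigma>: "\<sigma> \<in> flow_fan Q \<theta>"
      "\<And>b. b \<in> arcs Q \<Longrightarrow> \<not> arrow_ray Q b \<subseteq> \<sigma> \<Longrightarrow> w $ b \<noteq> 0"
      using w by (auto simp: cox_locus_def maximal_cones_def)
    then obtain F where "\<sigma> = ?N F" "F face_of ?P" "F \<noteq> {}"
      by (auto simp: flow_fan_def normal_fan_def)
    then obtain v where F: "\<sigma> = ?N F" "F \<subseteq> ?P" "v \<in> F"
      using face_of_imp_subset by blast
    have "w $ b \<noteq> 0" if b: "b \<in> arcs Q" "v $ b \<noteq> 0" for b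
    proof (rule \<sigma>(2)[OF b(1)])
      obtain y where "y \<in> ?P" "y $ b = 0"
        using facet[OF b(1)] by blast
      moreover have "v $ b > 0"
        using F b by (force simp: flow_polytope_def)
      \<comment> \<open>Otherwise \<open>ev Q b\<close> would be minimised over the polytope at
        \<open>v\<close>, although its value at \<open>y\<close> is smaller.\<close>
      ultimately show "\<not> arrow_ray Q b \<subseteq> \<sigma>"
        using F ev_in_normal_cone_iff[OF F(2), of b] by (force simp: arrow_ray_subset_iff[OF F(2)])
    qed
    then show "semistable (subquiver Q {b \<in> arcs Q. w $ b \<noteq> 0}) \<theta>"
      using F by (intro flow_imp_semistable[OF assms(1)]) auto
  qed
  moreover have "cox_locus Q (flow_fan Q \<theta>) \<subseteq> arrow_space Q"
    by (auto simp: cox_locus_def)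
  ultimately show ?thesis
    unfolding unstable_locus_def unstable_def by blast
qed

end
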